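(* In the curved $4$-body problem in $\mathbb H^3$ with equal masses $m_1=m_2=m_3=m_4=:m>0$, there are no negative elliptic-hyperbolic rectangular rotopulsators.
   Context: $\mathbb H^3=\{(w,x,y,z): w^2+x^2+y^2-z^2=-1,\ z>0\}$ in the Minkowski space $\mathbb R^{3,1}$, and $\cdot$ is the Lorentz inner product of signature $(+,+,+,-)$. The curved $4$-body problem in $\mathbb H^3$ describes the motion of bodies of masses $m_1,\dots,m_4>0$ with position vectors ${\bf q}_i=(w_i,x_i,y_i,z_i)$ through the equations $$\ddot{\bf q}_i=\sum_{j=1,\,j\ne i}^4\frac{m_j[{\bf q}_j+({\bf q}_i\cdot{\bf q}_j){\bf q}_i]}{[({\bf q}_i\cdot{\bf q}_j)^2-1]^{3/2}}+(\dot{\bf q}_i\cdot\dot{\bf q}_i){\bf q}_i,\qquad i=1,2,3,4,$$ with initial constraints $({\bf q}_i\cdot{\bf q}_i)(0)=-1$, $({\bf q}_i\cdot\dot{\bf q}_i)(0)=0$. Configurations with coinciding bodies are singular and excluded. Rotopulsators are orbits that rotate and may change size while maintaining their (equiangular) shape. Negative elliptic-hyperbolic rotopulsators have one elliptic rotation (through $\alpha$ in the $wx$-plane) and one hyperbolic rotation (through $\beta$ in the $yz$-plane). A negative elliptic-hyperbolic rectangular rotopulsator is a solution of the form $$w_1=r\cos\alpha,\ x_1=r\sin\alpha,\ y_1=\eta\sinh\beta,\ z_1=\eta\cosh\beta,$$ $$w_2=-r\cos\alpha,\ x_2=-r\sin\alpha,\ y_2=\eta\sinh\beta,\ z_2=\eta\cosh\beta,$$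 $$w_3=r\cos\alpha,\ x_3=r\sin\alpha,\ y_3=\eta\sinh(\beta+\phi),\ z_3=\eta\cosh(\beta+\phi),$$ $$w_4=-r\cos\alpha,\ x_4=-r\sin\alpha,\ y_4=\eta\sinh(\beta+\phi),\ z_4=\eta\cosh(\beta+\phi),$$ where $r,\eta,\alpha,\beta$ are functions of $t$ with $r^2-\eta^2=-1$, $z_i\ge1$ for $i=1,2,3,4$, $\alpha$ and $\beta$ are nonconstant, and $\phi\ne0$ is a constant. *)

theory Defs
  imports "HOL-Analysis.Analysis"
begin

text \<open>Vectors of Minkowski space are written \<open>(w, x, y, z)\<close>, with components \<open>$ 1, \<dots>, $ 4\<close>
  and the time-like component last.\<close>

lemma vector_4 [simp]:
  "(vector [w, x, y, z] :: 'a::zero ^ 4) $ 1 = w"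
  "(vector [w, x, y, z] :: 'a::zero ^ 4) $ 2 = x"
  "(vector [w, x, y, z] :: 'a::zero ^ 4) $ 3 = y"
  "(vector [w, x, y, z] :: 'a::zero ^ 4) $ 4 = z"
  unfolding vector_def by simp_all

definition lorentz :: "real ^ 4 \<Rightarrow> real ^ 4 \<Rightarrow> real"  (infix "\<bullet>\<^sub>L" 70)
  where "u \<bullet>\<^sub>L v = u $ 1 * v $ 1 + u $ 2 * v $ 2 + u $ 3 * v $ 3 - u $ 4 * v $ 4"

definition hyperbolic_space :: "(real ^ 4) set"
  where "hyperbolic_space = {u. u \<bullet>\<^sub>L u = -1 \<and> u $ 4 > 0}"

definition curved_accel ::
    "('n::finite \<Rightarrow> real) \<Rightarrow> ('n \<Rightarrow> real ^ 4) \<Rightarrow> ('n \<Rightarrow> real ^ 4) \<Rightarrow> 'n \<Rightarrow> real ^ 4"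
  where "curved_accel m p v i =
    (\<Sum>j \<in> UNIV - {i}.
       (m j / ((p i \<bullet>\<^sub>L p j)\<^sup>2 - 1) powr (3/2)) *\<^sub>R (p j + (p i \<bullet>\<^sub>L p j) *\<^sub>R p i))
    + (v i \<bullet>\<^sub>L v i) *\<^sub>R p i"

text \<open>The bodies are indexed by a finite type \<open>'n\<close>. A solution lives on an open time interval
  \<open>I\<close> containing the initial time \<open>0\<close>; \<open>v\<close> is the (necessarily unique) velocity.\<close>

definition curved_nbody_solution ::
    "('n::finite \<Rightarrow> real) \<Rightarrow> real set \<Rightarrow> ('n \<Rightarrow> real \<Rightarrow> real ^ 4) \<Rightarrow> bool"
  where "curved_nbody_solution m I q \<longleftrightarrow>
    open I \<and> is_interval I \<and> 0 \<in> I \<and>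
    (\<forall>t\<in>I. \<forall>i. q i t \<in> hyperbolic_space) \<and>
    (\<forall>t\<in>I. \<forall>i j. i \<noteq> j \<longrightarrow> q i t \<noteq> q j t) \<and>
    (\<exists>v :: 'n \<Rightarrow> real \<Rightarrow> real ^ 4.
       (\<forall>t\<in>I. \<forall>i.
          (q i has_vector_derivative v i t) (at t) \<and>
          (v i has_vector_derivative curved_accel m (\<lambda>j. q j t) (\<lambda>j. v j t) i) (at t)) \<and>
       (\<forall>i. q i 0 \<bullet>\<^sub>L q i 0 = -1 \<and> q i 0 \<bullet>\<^sub>L v i 0 = 0))"

text \<open>No regularity is imposed on \<open>r, \<eta>, \<alpha>, \<beta>\<close> beyond what the smoothness of the
  positions \<open>q\<close> forces.\<close>

definition neg_ell_hyp_rectangular_rotopulsator ::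
    "(4 \<Rightarrow> real) \<Rightarrow> real set \<Rightarrow> (4 \<Rightarrow> real \<Rightarrow> real ^ 4) \<Rightarrow> bool"
  where "neg_ell_hyp_rectangular_rotopulsator m I q \<longleftrightarrow>
    curved_nbody_solution m I q \<and>
    (\<exists>(r :: real \<Rightarrow> real) (\<eta> :: real \<Rightarrow> real) (\<alpha> :: real \<Rightarrow> real) (\<beta> :: real \<Rightarrow> real) (\<phi> :: real).
       \<phi> \<noteq> 0 \<and> \<not> \<alpha> constant_on I \<and> \<not> \<beta> constant_on I \<and>
       (\<forall>t\<in>I.
          q 1 t = vector [  r t * cos (\<alpha> t),   r t * sin (\<alpha> t),
                            \<eta> t * sinh (\<beta> t),  \<eta> t * cosh (\<beta> t)] \<and>
          q 2 t = vector [- r t * cos (\<alpha> t), - r t * sin (\<alpha> t),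
                            \<eta> t * sinh (\<beta> t),  \<eta> t * cosh (\<beta> t)] \<and>
          q 3 t = vector [  r t * cos (\<alpha> t),   r t * sin (\<alpha> t),
                            \<eta> t * sinh (\<beta> t + \<phi>),  \<eta> t * cosh (\<beta> t + \<phi>)] \<and>
          q 4 t = vector [- r t * cos (\<alpha> t), - r t * sin (\<alpha> t),
                            \<eta> t * sinh (\<beta> t + \<phi>),  \<eta> t * cosh (\<beta> t + \<phi>)] \<and>
          (r t)\<^sup>2 - (\<eta> t)\<^sup>2 = -1 \<and>
          (\<forall>i. q i t $ 4 \<ge> 1)))"

end

theory Submission
  imports Defs
begin

text \<open>The configuration is contradictory because gravity attracts. Bodies 3 and 4 are the images
  of bodies 1 and 2 under a fixed boost of the \<open>yz\<close>-plane, so bodies 1 and 3 have the same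
  boost-torque, i.e. the rate of change of the angular momentum in the \<open>yz\<close>-plane. However,
  bodies 3 and 4 exert on body 1 a torque with the sign of \<open>sinh \<phi>\<close>, while bodies 1 and 2 exert on
  body 3 exactly the opposite torque.\<close>

definition boost :: "real \<Rightarrow> real ^ 4 \<Rightarrow> real ^ 4"
  where "boost \<phi> u = vector [u $ 1, u $ 2,
    cosh \<phi> * u $ 3 + sinh \<phi> * u $ 4, sinh \<phi> * u $ 3 + cosh \<phi> * u $ 4]"

text \<open>For a position \<open>u\<close> with velocity \<open>w\<close> and acceleration
  \<open>a\<close>, differentiating the angular momentum
  \<open>w $ 3 * u $ 4 - w $ 4 * u $ 3\<close> cancels the terms quadratic in \<open>w\<close> and
  leaves this antisymmetric form.\<close>

definition yz_torque :: "real ^ 4 \<Rightarrow> real ^ 4 \<Rightarrow> real"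
  where "yz_torque u a = a $ 3 * u $ 4 - a $ 4 * u $ 3"

lemma bounded_linear_boost: "bounded_linear (boost \<phi>)"
  unfolding linear_conv_bounded_linear[symmetric]
  by (rule linearI) (auto simp: boost_def vec_eq_iff forall_4 algebra_simps)

text \<open>Up to sign the torque is a determinant in the yz-plane, and the boost acts there with
  determinant 1.\<close>

lemma yz_torque_boost: "yz_torque (boost \<phi> u) (boost \<phi> a) = yz_torque u a"
proof -
  have "yz_torque (boost \<phi> u) (boost \<phi> a) = ((cosh \<phi>)\<^sup>2 - (sinh \<phi>)\<^sup>2) * yz_torque u a"
    unfolding yz_torque_def boost_def vector_4 by algebra
  then show ?thesis
    by (simp add: hyperbolic_pythagoras)
qed

lemma yz_torque_add: "yz_torque u (a + b) = yz_torque u a + yz_torque u b"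
  and yz_torque_scaleR: "yz_torque u (c *\<^sub>R a) = c * yz_torque u a"
  and yz_torque_self: "yz_torque u u = 0"
  by (simp_all add: yz_torque_def algebra_simps)

lemma yz_torque_sum: "yz_torque u (\<Sum>j\<in>A. f j) = (\<Sum>j\<in>A. yz_torque u (f j))"
  by (simp add: yz_torque_def sum_subtractf sum_distrib_right)

text \<open>Both the constraint term and the projection part of each force are multiples of
  \<open>p i\<close>, so they exert no torque. The velocities disappear, and only the pulls towards
  the other bodies remain.\<close>

lemma yz_torque_curved_accel:
  "yz_torque (p i) (curved_accel m p v i) =
    (\<Sum>j\<in>UNIV - {i}. m j / ((p i \<bullet>\<^sub>L p j)\<^sup>2 - 1) powr (3/2) * yz_torque (p i) (p j))"
  by (simp add: curved_accel_def yz_torque_add yz_torque_scaleR yz_torque_self yz_torque_sum)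

text \<open>This transports accelerations between bodies. Since \<open>I\<close> is open, the
  relation between \<open>f\<close> and \<open>g\<close> can be differentiated at every point of
  \<open>I\<close>; the resulting relation between velocities is then differentiated once more at
  \<open>t\<close>.\<close>

lemma second_derivative_bounded_linear_image:
  fixes f g :: "real \<Rightarrow> 'a::real_normed_vector"
  assumes L: "bounded_linear L" and I: "open I" "t \<in> I"
    and eq: "\<And>s. s \<in> I \<Longrightarrow> g s = L (f s)"
    and f: "\<And>s. s \<in> I \<Longrightarrow> (f has_vector_derivative f' s) (at s)"
    and f': "(f' has_vector_derivative f'') (at t)"
    and g: "\<And>s. s \<in> I \<Longrightarrow> (g has_vector_derivative g' s) (at s)"
    and g': "(g' has_vector_derivative g'') (at t)"
  shows "g'' = L f''"
proof -
  have "g' s = L (f' s)" if "s \<in> I" for s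
  proof -
    have "(g has_vector_derivative L (f' s)) (at s)"
      by (rule has_vector_derivative_transform_within_open
          [OF bounded_linear.has_vector_derivative[OF L f[OF that]] I(1) that])
        (simp add: eq)
    with g[OF that] show ?thesis
      by (rule vector_derivative_unique_at)
  qed
  then have "(g' has_vector_derivative L f'') (at t)"
    by (intro has_vector_derivative_transform_within_open
        [OF bounded_linear.has_vector_derivative[OF L f'] I]) simp
  with g' show ?thesis
    by (rule vector_derivative_unique_at)
qed

theorem theorem7:
  fixes m :: real
  assumes "m > 0"
  shows "\<not> (\<exists>(I :: real set) (q :: 4 \<Rightarrow> real \<Rightarrow> real ^ 4).
               neg_ell_hyp_rectangular_rotopulsator (\<lambda>_. m) I q)"
proof
  assume "\<exists>(I :: real set) (q :: 4 \<Rightarrow> real \<Rightarrow> real ^ 4).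
    neg_ell_hyp_rectangular_rotopulsator (\<lambda>_. m) I q"
  then obtain I :: "real set" and q :: "4 \<Rightarrow> real \<Rightarrow> real ^ 4" and r \<eta> \<alpha> \<beta> \<phi>
    where sol: "curved_nbody_solution (\<lambda>_. m) I q" and "\<phi> \<noteq> 0"
      and q: "\<And>t. t \<in> I \<Longrightarrow>
          q 1 t = vector [  r t * cos (\<alpha> t),   r t * sin (\<alpha> t),
                            \<eta> t * sinh (\<beta> t),  \<eta> t * cosh (\<beta> t)] \<and>
          q 2 t = vector [- r t * cos (\<alpha> t), - r t * sin (\<alpha> t),
                            \<eta> t * sinh (\<beta> t),  \<eta> t * cosh (\<beta> t)] \<and>
          q 3 t = vector [  r t * cos (\<alpha> t),   r t * sin (\<alpha> t),
                            \<eta> t * sinh (\<beta> t + \<phi>),  \<eta> t * cosh (\<beta> t + \<phi>)] \<and>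
          q 4 t = vector [- r t * cos (\<alpha> t), - r t * sin (\<alpha> t),
                            \<eta> t * sinh (\<beta> t + \<phi>),  \<eta> t * cosh (\<beta> t + \<phi>)]"
      and r\<eta>: "\<And>t. t \<in> I \<Longrightarrow> (r t)\<^sup>2 - (\<eta> t)\<^sup>2 = -1"
    unfolding neg_ell_hyp_rectangular_rotopulsator_def by blast
  from sol have "open I" "0 \<in> I"
    by (auto simp: curved_nbody_solution_def)
  from sol obtain v where "\<forall>t\<in>I. \<forall>i. (q i has_vector_derivative v i t) (at t) \<and>
      (v i has_vector_derivative curved_accel (\<lambda>_. m) (\<lambda>j. q j t) (\<lambda>j. v j t) i) (at t)"
    unfolding curved_nbody_solution_def by (elim conjE exE) (rule that)
  then have v: "(q i has_vector_derivative v i t) (at t)"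
    and a: "(v i has_vector_derivative curved_accel (\<lambda>_. m) (\<lambda>j. q j t) (\<lambda>j. v j t) i) (at t)"
    if "t \<in> I" for t i
    using that by simp_all
  \<comment> \<open>The contradiction is instantaneous, so it is sought at time 0, which is known to
    lie in \<open>I\<close>.\<close>
  define p where "p = (\<lambda>j. q j 0)"
  define acc where "acc = curved_accel (\<lambda>_. m) p (\<lambda>j. v j 0)"
  \<comment> \<open>As \<phi> is constant in time, one linear map carries body 1 to body 3
    throughout \<open>I\<close>.\<close>
  have boost: "q 3 t = boost \<phi> (q 1 t)" if "t \<in> I" for t
    using q[OF that]
    by (simp add: boost_def vec_eq_iff forall_4 sinh_add cosh_add algebra_simps)
  have "acc 3 = boost \<phi> (acc 1)"
    unfolding acc_def p_def
    by (rule second_derivative_bounded_linear_image[where f = "q 1" and f' = "v 1"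
          and g = "q 3" and g' = "v 3", OF bounded_linear_boost \<open>open I\<close> \<open>0 \<in> I\<close>])
      (use boost v a \<open>0 \<in> I\<close> in blast)+
  then have same_torque: "yz_torque (p 3) (acc 3) = yz_torque (p 1) (acc 1)"
    using boost[OF \<open>0 \<in> I\<close>] by (simp add: p_def yz_torque_boost)

  define R H c where "R = (r 0)\<^sup>2" and "H = (\<eta> 0)\<^sup>2" and "c = cosh \<phi>"
  \<comment> \<open>The two summands are the force coefficients between bodies on the same side
    (equal w and x) and on opposite sides; bodies 1 and 3 see the same pair.\<close>
  define B where "B = m / ((R - H * c)\<^sup>2 - 1) powr (3/2) + m / ((- R - H * c)\<^sup>2 - 1) powr (3/2)"
  have RH: "R = H - 1" "R \<ge> 0"
    using r\<eta>[OF \<open>0 \<in> I\<close>] by (auto simp: R_def H_def)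
  have "c > 1"
    using \<open>\<phi> \<noteq> 0\<close> cosh_real_ge_1[of \<phi>] by (simp add: c_def order_less_le)
  have p: "p 1 = vector [r 0 * cos (\<alpha> 0), r 0 * sin (\<alpha> 0), \<eta> 0 * sinh (\<beta> 0), \<eta> 0 * cosh (\<beta> 0)]"
    "p 2 = vector [- r 0 * cos (\<alpha> 0), - r 0 * sin (\<alpha> 0), \<eta> 0 * sinh (\<beta> 0), \<eta> 0 * cosh (\<beta> 0)]"
    "p 3 = vector [r 0 * cos (\<alpha> 0), r 0 * sin (\<alpha> 0),
       \<eta> 0 * sinh (\<beta> 0 + \<phi>), \<eta> 0 * cosh (\<beta> 0 + \<phi>)]"
    "p 4 = vector [- r 0 * cos (\<alpha> 0), - r 0 * sin (\<alpha> 0),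
       \<eta> 0 * sinh (\<beta> 0 + \<phi>), \<eta> 0 * cosh (\<beta> 0 + \<phi>)]"
    using q[OF \<open>0 \<in> I\<close>] by (simp_all add: p_def)
  have hyp: "\<eta> 0 * sinh (\<beta> 0 + \<phi>) = \<eta> 0 * sinh (\<beta> 0) * c + \<eta> 0 * cosh (\<beta> 0) * sinh \<phi>"
    "\<eta> 0 * cosh (\<beta> 0 + \<phi>) = \<eta> 0 * cosh (\<beta> 0) * c + \<eta> 0 * sinh (\<beta> 0) * sinh \<phi>"
    "(\<eta> 0 * cosh (\<beta> 0))\<^sup>2 - (\<eta> 0 * sinh (\<beta> 0))\<^sup>2 = H"
    by (simp_all add: sinh_add cosh_add c_def H_def cosh_square_eq algebra_simps)
  have trig: "(r 0 * cos (\<alpha> 0))\<^sup>2 + (r 0 * sin (\<alpha> 0))\<^sup>2 = R"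
    by (simp add: R_def power_mult_distrib flip: distrib_left)
  have torque: "yz_torque (p 1) (p 2) = 0" "yz_torque (p 3) (p 4) = 0"
    "yz_torque (p 1) (p 3) = H * sinh \<phi>" "yz_torque (p 1) (p 4) = H * sinh \<phi>"
    "yz_torque (p 3) (p 1) = - (H * sinh \<phi>)" "yz_torque (p 3) (p 2) = - (H * sinh \<phi>)"
    \<comment> \<open>Writing \<open>H\<close> back as a difference of squares turns each claim into
      a polynomial identity.\<close>
    unfolding p yz_torque_def vector_4 hyp(1,2) hyp(3)[symmetric]
    by (simp_all add: algebra_simps power2_eq_square)
  have inner: "p 1 \<bullet>\<^sub>L p 3 = R - H * c" "p 1 \<bullet>\<^sub>L p 4 = - R - H * c"
    "p 3 \<bullet>\<^sub>L p 1 = R - H * c" "p 3 \<bullet>\<^sub>L p 2 = - R - H * c"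
    unfolding p lorentz_def vector_4 hyp(1,2) hyp(3)[symmetric] trig[symmetric]
    by (simp_all add: algebra_simps power2_eq_square)
  have others: "UNIV - {1} = {2, 3, 4 :: 4}" "UNIV - {3} = {1, 2, 4 :: 4}"
    unfolding UNIV_4 by auto
  \<comment> \<open>Body 2 shares the yz-components of body 1 and contributes nothing; bodies 3 and
    4 contribute with the same sign.\<close>
  have "yz_torque (p 1) (acc 1) = B * (H * sinh \<phi>)"
    unfolding acc_def yz_torque_curved_accel others
    by (simp add: torque inner B_def algebra_simps)
  moreover have "yz_torque (p 3) (acc 3) = - (B * (H * sinh \<phi>))"
    unfolding acc_def yz_torque_curved_accel others
    by (simp add: torque inner B_def algebra_simps)
  ultimately have "B * (H * sinh \<phi>) = 0"
    using same_torque by linarith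
  moreover have "H > 0" "sinh \<phi> \<noteq> 0"
    using RH \<open>\<phi> \<noteq> 0\<close> by auto
  moreover have "B > 0"
  proof -
    have "H * c > H"
      using \<open>c > 1\<close> \<open>H > 0\<close> by simp
    then have "R - H * c < -1" "- R - H * c < -1"
      using RH by linarith+
    \<comment> \<open>\<open>powr\<close> is positive at every nonzero base, so it suffices that
      neither base vanishes.\<close>
    then have "(R - H * c)\<^sup>2 \<noteq> 1" "(- R - H * c)\<^sup>2 \<noteq> 1"
      by (auto simp: power2_eq_1_iff)
    then show ?thesis
      unfolding B_def using \<open>m > 0\<close> by (intro add_pos_pos divide_pos_pos) auto
  qed
  ultimately show False
    by simp
qed

end
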